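(* Let $\mathcal X=\{1,\dots,n\}$, let $M=(m_{ij})_{i,j\in\mathcal X}$ be a time-invariant matrix with nonnegative entries (the transition matrix of the prior measure, rows not necessarily summing to one), let $\mu$ be a vector on $\mathcal X$ with $\mu(i)>0$ for all $i$, and let $\pi$ be a probability distribution on $\mathcal X$. Assume that $M$ is reversible with respect to $\mu$, i.e. $$\mathrm{Diag}(\mu)\,M=M'\,\mathrm{Diag}(\mu).$$ Let $\Pi^*=(\pi^*_{ij})$ be the solution of the stationary Schrödinger bridge problem $$\min_{(\pi_{ij})}\ \sum_{i\in\mathcal X}\mathfrak D\big(\pi_{i\,\cdot}\,\|\,m_{i\,\cdot}\big)\,\pi(i)$$ $$\text{subject to}\quad \sum_{i\in\mathcal X}\pi_{ij}\,\pi(i)=\pi(j)\ \ (j\in\mathcal X),\qquad \sum_{j\in\mathcal X}\pi_{ij}=1\ \ (i\in\mathcal X).$$ Then $\Pi^*$ is also reversible with respect to $\pi$, i.e. $$\mathrm{Diag}(\pi)\,\Pi^*=(\Pi^* )'\,\mathrm{Diag}(\pi).$$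
   Context: Prime denotes transposition; $\mathrm{Diag}(v)$ is the diagonal matrix with the entries of the vector $v$ on the diagonal. The minimization is over matrices $(\pi_{ij})$ with nonnegative entries. $\pi_{i\,\cdot}$ and $m_{i\,\cdot}$ denote $i$-th rows. Relative entropy: for a probability vector $a$ and a nonnegative vector $b$ on $\mathcal X$, $\mathfrak D(a\|b)=\sum_j a(j)\log\frac{a(j)}{b(j)}$ if $\mathrm{Supp}(a)\subseteq\mathrm{Supp}(b)$ and $+\infty$ otherwise, with $0\log0=0$; the convention $0\cdot(+\infty)=0$ is used for rows with $\pi(i)=0$. A solution of the problem means a feasible matrix attaining the minimum, with finite minimum value. *)

theory Defs
  imports "HOL-Analysis.Analysis"
begin

definition Diag :: "real ^ 'n \<Rightarrow> real ^ 'n ^ 'n"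
  where "Diag v = (\<chi> i j. if i = j then v $ i else 0)"

definition reversible_wrt :: "real ^ 'n \<Rightarrow> real ^ 'n ^ 'n \<Rightarrow> bool"
  where "reversible_wrt v A \<longleftrightarrow> Diag v ** A = transpose A ** Diag v"

definition prob_vector :: "real ^ 'n \<Rightarrow> bool"
  where "prob_vector p \<longleftrightarrow> (\<forall>i. p $ i \<ge> 0) \<and> (\<Sum>i\<in>UNIV. p $ i) = 1"

definition Supp :: "real ^ 'n \<Rightarrow> 'n set"
  where "Supp v = {i. v $ i \<noteq> 0}"

(* Terms with a $ j = 0 vanish because 0 * x = 0 in HOL, which is the convention
   0 log 0 = 0.  As b need not have total mass one, the value can be negative. *)
definition rel_entropy :: "real ^ 'n \<Rightarrow> real ^ 'n \<Rightarrow> ereal"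
  where "rel_entropy a b =
    (if Supp a \<subseteq> Supp b then ereal (\<Sum>j\<in>UNIV. a $ j * ln (a $ j / b $ j)) else \<infinity>)"

definition sb_feasible :: "real ^ 'n \<Rightarrow> real ^ 'n ^ 'n \<Rightarrow> bool"
  where "sb_feasible p P \<longleftrightarrow>
    (\<forall>i j. P $ i $ j \<ge> 0) \<and>
    (\<forall>j. (\<Sum>i\<in>UNIV. P $ i $ j * p $ i) = p $ j) \<and>
    (\<forall>i. (\<Sum>j\<in>UNIV. P $ i $ j) = 1)"

(* In ereal, \<infinity> * 0 = 0, so rows with p $ i = 0 contribute nothing, whatever their
   support.  No summand is -\<infinity>. *)
definition sb_cost :: "real ^ 'n ^ 'n \<Rightarrow> real ^ 'n \<Rightarrow> real ^ 'n ^ 'n \<Rightarrow> ereal"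
  where "sb_cost M p P = (\<Sum>i\<in>UNIV. rel_entropy (row i P) (row i M) * ereal (p $ i))"

(* Rows with p $ i = 0 are not determined by the problem, so a solution is a minimizer
   rather than the unique one. *)
definition sb_solution :: "real ^ 'n ^ 'n \<Rightarrow> real ^ 'n \<Rightarrow> real ^ 'n ^ 'n \<Rightarrow> bool"
  where "sb_solution M p P \<longleftrightarrow>
    sb_feasible p P \<and>
    (\<forall>Q. sb_feasible p Q \<longrightarrow> sb_cost M p P \<le> sb_cost M p Q) \<and>
    \<bar>sb_cost M p P\<bar> \<noteq> \<infinity>"

end

theory Submission
  imports Defs
begin

text \<open>
  In terms of the joint law \<open>x\<^sub>i\<^sub>j = \<pi>(i) \<pi>\<^sub>i\<^sub>j\<close>, both of whose marginals are \<open>\<pi>\<close>, and of the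
  symmetric matrix \<open>s\<^sub>i\<^sub>j = \<mu>(i) m\<^sub>i\<^sub>j\<close>, the cost equals \<open>\<Sum> x\<^sub>i\<^sub>j ln (x\<^sub>i\<^sub>j / s\<^sub>i\<^sub>j)\<close> up to a
  constant. This functional is invariant under transposing \<open>x\<close>, and \<open>t ln t\<close> is strictly
  convex, so replacing \<open>x\<close> by \<open>(x + x') / 2\<close> strictly lowers the cost unless \<open>x = x'\<close>.
\<close>

text \<open>The graph of \<open>t * ln t\<close> lies above its tangent at \<open>z\<close>, and
  touches it only there. For \<open>a > 0\<close> this is \<open>ln t \<le> t - 1\<close> at
  \<open>t = z / a\<close>, with equality only at \<open>t = 1\<close>; for \<open>a = 0\<close> it
  reduces to \<open>0 < z\<close>.\<close>

lemma mult_ln_tangent: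
  fixes a z :: real
  assumes "0 \<le> a" "0 < z"
  shows "a * ln z \<le> a * ln a + (z - a)"
    and "a \<noteq> z \<Longrightarrow> a * ln z < a * ln a + (z - a)"
proof -
  have *: "a * ln z \<le> a * ln a + (z - a) \<and> (a \<noteq> z \<longrightarrow> a * ln z < a * ln a + (z - a))"
  proof (cases "a = 0")
    case True
    then show ?thesis using assms by auto
  next
    case False
    then have a: "0 < a" using assms by simp
    have ln: "ln (z / a) = ln z - ln a" using a assms by (simp add: ln_div)
    have lt: "ln (z / a) < z / a - 1" if "a \<noteq> z"
      using ln_le_minus_one[of "z / a"] ln_eq_minus_one[of "z / a"] a assms that
      by (fastforce simp: less_le)
    have "a * (ln z - ln a) < a * (z / a - 1)" if "a \<noteq> z"
      using lt[OF that] a unfolding ln by (rule mult_strict_left_mono)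
    moreover have "a * (z / a - 1) = z - a" using a by (simp add: field_simps)
    moreover have "a * (ln z - ln a) = a * ln z - a * ln a" by (rule right_diff_distrib)
    ultimately have "a \<noteq> z \<longrightarrow> a * ln z < a * ln a + (z - a)" by linarith
    then show ?thesis by (cases "a = z") auto
  qed
  show "a * ln z \<le> a * ln a + (z - a)" "a \<noteq> z \<Longrightarrow> a * ln z < a * ln a + (z - a)"
    using * by auto
qed

text \<open>Both points are compared with the tangent at their midpoint; the corrections
  \<open>z - a\<close> and \<open>z - b\<close> cancel.\<close>

lemma mult_ln_midpoint:
  fixes a b :: real
  assumes "0 \<le> a" "0 \<le> b"
  shows "2 * ((a + b) / 2 * ln ((a + b) / 2)) \<le> a * ln a + b * ln b"
    and "a \<noteq> b \<Longrightarrow> 2 * ((a + b) / 2 * ln ((a + b) / 2)) < a * ln a + b * ln b"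
proof -
  define z where "z = (a + b) / 2"
  have split: "2 * (z * ln z) = a * ln z + b * ln z" and sum: "(z - a) + (z - b) = 0"
    by (auto simp: z_def field_simps)
  show "2 * ((a + b) / 2 * ln ((a + b) / 2)) < a * ln a + b * ln b" if "a \<noteq> b"
  proof -
    have z: "0 < z" "a \<noteq> z" "b \<noteq> z" using assms that by (auto simp: z_def)
    show ?thesis
      using mult_ln_tangent(2)[of a z] mult_ln_tangent(2)[of b z] z assms split sum
      unfolding z_def[symmetric] by linarith
  qed
  then show "2 * ((a + b) / 2 * ln ((a + b) / 2)) \<le> a * ln a + b * ln b"
    by (cases "a = b") auto
qed

lemma reversible_wrt_iff:
  "reversible_wrt v A \<longleftrightarrow> (\<forall>i j. v $ i * A $ i $ j = v $ j * A $ j $ i)"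
proof -
  have "(Diag v ** A) $ i $ j = v $ i * A $ i $ j" for i j
    by (simp add: Diag_def matrix_matrix_mult_def if_distrib[of "\<lambda>t. t * _"] cong: if_cong)
  moreover have "(transpose A ** Diag v) $ i $ j = v $ j * A $ j $ i" for i j
    by (simp add: Diag_def matrix_matrix_mult_def transpose_def if_distrib mult.commute cong: if_cong)
  ultimately show ?thesis
    by (simp add: reversible_wrt_def vec_eq_iff)
qed

lemma sb_cost_eq_sum:
  assumes "\<And>i j. p $ i \<noteq> 0 \<Longrightarrow> P $ i $ j \<noteq> 0 \<Longrightarrow> M $ i $ j \<noteq> 0"
  shows "sb_cost M p P =
    ereal (\<Sum>i\<in>UNIV. \<Sum>j\<in>UNIV. p $ i * P $ i $ j * ln (P $ i $ j / M $ i $ j))"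
proof -
  have "rel_entropy (row i P) (row i M) * ereal (p $ i) =
      ereal (\<Sum>j\<in>UNIV. p $ i * P $ i $ j * ln (P $ i $ j / M $ i $ j))" for i
  proof (cases "p $ i = 0")
    case False
    then have "Supp (row i P) \<subseteq> Supp (row i M)"
      using assms by (auto simp: Supp_def row_def)
    then show ?thesis
      by (simp add: rel_entropy_def row_def sum_distrib_left mult_ac)
  qed (simp flip: zero_ereal_def)
  then show ?thesis
    by (simp add: sb_cost_def)
qed

text \<open>A sum in \<open>ereal\<close> has infinite absolute value as soon as one summand does,
  so finite cost forces the support condition on every row of nonzero weight.\<close>

lemma sb_cost_finite_support:
  assumes fin: "\<bar>sb_cost M p P\<bar> \<noteq> \<infinity>" and "p $ i \<noteq> 0" "P $ i $ j \<noteq> 0"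
  shows "M $ i $ j \<noteq> 0"
proof
  assume "M $ i $ j = 0"
  then have "rel_entropy (row i P) (row i M) = \<infinity>"
    using assms(3) by (auto simp: rel_entropy_def Supp_def row_def)
  then have "\<bar>rel_entropy (row i P) (row i M) * ereal (p $ i)\<bar> = \<infinity>"
    using assms(2) by simp
  then show False
    using fin unfolding sb_cost_def by (subst (asm) sum_Inf) auto
qed

text \<open>Writing \<open>P / M = (x / (\<mu> * M)) / (p / \<mu>)\<close> splits the logarithm into
  three. Since rows of \<open>P\<close> sum to one, the last part depends only on \<open>p\<close>
  and \<open>\<mu>\<close>. Taking \<open>x\<close> as a hypothesis lets the lemma serve both
  \<open>P\<close> and its symmetrized competitor.\<close>

lemma sb_cost_joint_law:
  fixes M P :: "real ^ 'n ^ 'n" and \<mu> p :: "real ^ 'n"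
  assumes M: "\<And>i j. M $ i $ j \<ge> 0"
    and mu: "\<And>i. \<mu> $ i > 0"
    and p: "\<And>i. p $ i \<ge> 0"
    and feas: "sb_feasible p P"
    and supp: "\<And>i j. p $ i \<noteq> 0 \<Longrightarrow> P $ i $ j \<noteq> 0 \<Longrightarrow> M $ i $ j \<noteq> 0"
    and x: "\<And>i j. x i j = p $ i * P $ i $ j"
  shows "sb_cost M p P =
    ereal ((\<Sum>i\<in>UNIV. \<Sum>j\<in>UNIV. x i j * ln (x i j)) -
      (\<Sum>i\<in>UNIV. \<Sum>j\<in>UNIV. x i j * ln (\<mu> $ i * M $ i $ j)) -
      (\<Sum>i\<in>UNIV. p $ i * ln (p $ i / \<mu> $ i)))"
proof -
  have P: "P $ i $ j \<ge> 0" "(\<Sum>j\<in>UNIV. P $ i $ j) = 1" for i j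
    using feas by (auto simp: sb_feasible_def)
  have "p $ i * P $ i $ j * ln (P $ i $ j / M $ i $ j) =
      x i j * ln (x i j) - x i j * ln (\<mu> $ i * M $ i $ j) - x i j * ln (p $ i / \<mu> $ i)" for i j
  proof (cases "x i j = 0")
    case True
    then show ?thesis using x[of i j] by auto
  next
    case False
    then have "p $ i > 0" "P $ i $ j > 0" "M $ i $ j > 0" "\<mu> $ i > 0"
      using x[of i j] p[of i] P(1)[of i j] M[of i j] mu[of i] supp[of i j] by (auto simp: less_le)
    then show ?thesis
      unfolding x by (simp add: ln_mult ln_div algebra_simps)
  qed
  moreover have "(\<Sum>j\<in>UNIV. x i j * ln (p $ i / \<mu> $ i)) = p $ i * ln (p $ i / \<mu> $ i)" for i
    by (simp add: x P(2) flip: sum_distrib_right sum_distrib_left)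
  ultimately show ?thesis
    by (simp add: sb_cost_eq_sum[OF supp] sum_subtractf)
qed

theorem theorem12:
  fixes M P :: "real ^ 'n ^ 'n" and \<mu> p :: "real ^ 'n"
  assumes "\<And>i j. M $ i $ j \<ge> 0"
    and "\<And>i. \<mu> $ i > 0"
    and "prob_vector p"
    and "reversible_wrt \<mu> M"
    and "sb_solution M p P"
  shows "reversible_wrt p P"
proof (rule ccontr)
  assume "\<not> reversible_wrt p P"
  define x where "x i j = p $ i * P $ i $ j" for i j
  define z where "z i j = (x i j + x j i) / 2" for i j
  define s where "s i j = \<mu> $ i * M $ i $ j" for i j
  \<comment> \<open>On rows with \<open>p $ i = 0\<close> the joint law \<open>z\<close> does not determine \<open>Q\<close>; any stochastic row works.\<close>
  define Q :: "real ^ 'n ^ 'n"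
    where "Q = (\<chi> i j. if p $ i = 0 then P $ i $ j else z i j / p $ i)"
  have p: "p $ i \<ge> 0" for i
    using assms(3) by (simp add: prob_vector_def)
  have feas: "sb_feasible p P" and fin: "\<bar>sb_cost M p P\<bar> \<noteq> \<infinity>"
    and opt: "\<And>R. sb_feasible p R \<Longrightarrow> sb_cost M p P \<le> sb_cost M p R"
    using assms(5) by (auto simp: sb_solution_def)
  have P: "P $ i $ j \<ge> 0" for i j
    using feas by (simp add: sb_feasible_def)
  have x: "x i j \<ge> 0" for i j
    by (simp add: x_def p P)
  have rows: "(\<Sum>j\<in>UNIV. x i j) = p $ i" and cols: "(\<Sum>i\<in>UNIV. x i j) = p $ j" for i j
    using feas by (simp_all add: x_def sb_feasible_def mult.commute flip: sum_distrib_left)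
  have z: "z i j \<ge> 0" "z i j = z j i" for i j
    by (simp_all add: z_def x add.commute)
  have zrows: "(\<Sum>j\<in>UNIV. z i j) = p $ i" for i
    by (simp add: z_def rows cols sum.distrib flip: sum_divide_distrib)
  have zcols: "(\<Sum>i\<in>UNIV. z i j) = p $ j" for j
    using zrows[of j] by (simp add: z(2)[of j])
  \<comment> \<open>If \<open>p $ i = 0\<close>, the nonnegative entries of row \<open>i\<close> of
    \<open>z\<close> sum to zero, hence all vanish.\<close>
  have Q: "z i j = p $ i * Q $ i $ j" for i j
  proof (cases "p $ i = 0")
    case True
    then have "z i j = 0"
      using zrows[of i] z(1) by (simp add: sum_nonneg_eq_0_iff)
    then show ?thesis using True by simp
  qed (simp add: Q_def)
  have Qfeas: "sb_feasible p Q"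
    unfolding sb_feasible_def
  proof (intro conjI allI)
    show "Q $ i $ j \<ge> 0" for i j
      using P p z by (simp add: Q_def)
    show "(\<Sum>i\<in>UNIV. Q $ i $ j * p $ i) = p $ j" for j
      using zcols[of j] by (simp add: Q mult.commute)
    show "(\<Sum>j\<in>UNIV. Q $ i $ j) = 1" for i
    proof (cases "p $ i = 0")
      case True
      then show ?thesis using feas by (simp add: Q_def sb_feasible_def)
    next
      case False
      then show ?thesis using zrows[of i] by (simp add: Q_def flip: sum_divide_distrib)
    qed
  qed
  have s: "s i j = s j i" for i j
    using assms(4) by (simp add: s_def reversible_wrt_iff)
  have supp: "M $ i $ j \<noteq> 0" if "p $ i \<noteq> 0" "P $ i $ j \<noteq> 0" for i j
    using sb_cost_finite_support[OF fin that] .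
  have s_nz: "s i j \<noteq> 0" if "x i j \<noteq> 0" for i j
    using supp[of i j] that assms(2)[of i] by (auto simp: s_def x_def)
  \<comment> \<open>Symmetrizing may enlarge the support of \<open>x\<close>, but only by transposed
    positions, where \<open>s\<close> is nonzero by symmetry. Hence the competitor also has finite
    cost.\<close>
  have Qsupp: "M $ i $ j \<noteq> 0" if "p $ i \<noteq> 0" "Q $ i $ j \<noteq> 0" for i j
  proof -
    have "z i j \<noteq> 0" using that by (simp add: Q)
    then have "x i j \<noteq> 0 \<or> x j i \<noteq> 0" by (auto simp: z_def)
    then have "s i j \<noteq> 0" using s_nz s by metis
    then show ?thesis by (simp add: s_def)
  qed
  have transp: "(\<Sum>i\<in>UNIV. \<Sum>j\<in>UNIV. g j i) = (\<Sum>i\<in>UNIV. \<Sum>j\<in>UNIV. g i j)"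
    for g :: "'n \<Rightarrow> 'n \<Rightarrow> real"
    by (rule sum.swap)
  \<comment> \<open>Reversibility of \<open>M\<close> enters here: a transpose on \<open>x\<close>
    can be moved to the symmetric \<open>s\<close>, so the part linear in the joint law agrees for
    \<open>x\<close> and \<open>z\<close>.\<close>
  have "(\<Sum>i\<in>UNIV. \<Sum>j\<in>UNIV. x j i * ln (s i j)) = (\<Sum>i\<in>UNIV. \<Sum>j\<in>UNIV. x i j * ln (s i j))"
    using transp[of "\<lambda>i j. x i j * ln (s i j)"] by (simp add: s)
  then have lin: "(\<Sum>i\<in>UNIV. \<Sum>j\<in>UNIV. z i j * ln (s i j)) =
      (\<Sum>i\<in>UNIV. \<Sum>j\<in>UNIV. x i j * ln (s i j))"
    by (simp add: z_def add_divide_distrib distrib_right sum.distrib flip: sum_divide_distrib)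
  have "sb_cost M p P \<le> sb_cost M p Q"
    by (rule opt[OF Qfeas])
  then have le: "(\<Sum>i\<in>UNIV. \<Sum>j\<in>UNIV. x i j * ln (x i j)) \<le> (\<Sum>i\<in>UNIV. \<Sum>j\<in>UNIV. z i j * ln (z i j))"
    using lin
    by (simp add: sb_cost_joint_law[OF assms(1,2) p feas supp x_def]
        sb_cost_joint_law[OF assms(1,2) p Qfeas Qsupp Q] flip: s_def)
  obtain k l where kl: "x k l \<noteq> x l k"
    using \<open>\<not> reversible_wrt p P\<close> by (auto simp: reversible_wrt_iff x_def)
  have mid: "2 * (z i j * ln (z i j)) \<le> x i j * ln (x i j) + x j i * ln (x j i)" for i j
    using mult_ln_midpoint(1)[OF x x] by (simp add: z_def)
  \<comment> \<open>The midpoint inequality is summed over all entries; the asymmetric entry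
    \<open>(k, l)\<close> makes it strict.\<close>
  have "(\<Sum>i\<in>UNIV. \<Sum>j\<in>UNIV. 2 * (z i j * ln (z i j))) <
      (\<Sum>i\<in>UNIV. \<Sum>j\<in>UNIV. x i j * ln (x i j) + x j i * ln (x j i))"
  proof (rule sum_strict_mono_ex1)
    show "\<exists>i\<in>UNIV. (\<Sum>j\<in>UNIV. 2 * (z i j * ln (z i j))) <
        (\<Sum>j\<in>UNIV. x i j * ln (x i j) + x j i * ln (x j i))"
    proof (rule bexI[of _ k], rule sum_strict_mono_ex1)
      show "\<exists>j\<in>UNIV. 2 * (z k j * ln (z k j)) < x k j * ln (x k j) + x j k * ln (x j k)"
        using mult_ln_midpoint(2)[OF x x kl] by (auto simp: z_def)
    qed (use mid in auto)
  qed (use mid in \<open>auto intro: sum_mono\<close>)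
  \<comment> \<open>After swapping indices the right-hand side is twice the sum of
    \<open>x i j * ln (x i j)\<close>, contradicting \<open>le\<close>.\<close>
  then show False
    using le transp[of "\<lambda>i j. x i j * ln (x i j)"]
    by (simp add: sum.distrib flip: sum_distrib_left)
qed

end
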